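(* Let $H$ be a finite simple graph with positive integer edge weights such that there is no pair of vertices of $H$ between which there are two or more distinct geodesics of length $2$. Then there exists a weighted geodetic graph $G$ containing $H$ as an induced subgraph (the edges of $G$ between vertices of $H$ are exactly the edges of $H$, with the same weights), such that every edge of $G$ not belonging to $H$ has weight $1$ or $2$.
   Context: In an edge-weighted graph, the length of a path is the sum of the weights of its edges, and a geodesic between two vertices is a path of minimum length between them. A weighted graph is geodetic if between any two of its vertices there is exactly one geodesic. *)

theory Defs
  imports "Graph_Theory.Graph_Theory"
begin

text \<open>
  A finite simple graph is a symmetric loop-free digraph without parallel arcs: the edge
  \<open>{u, v}\<close> is represented by the two arcs \<open>(u, v)\<close> and \<open>(v, u)\<close>. An edge weighting is
  therefore a weight function on arcs that gives both directions of an edge the same weight.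
  A path of the undirected graph traversed from \<open>u\<close> to \<open>v\<close> is then exactly one \<open>apath\<close>
  from \<open>u\<close> to \<open>v\<close>.
\<close>

locale weighted_graph = pair_graph G
  for G :: "'a pair_pre_digraph" +
  fixes c :: "('a \<times> 'a) weight_fun"
  assumes weight_sym: "(u, v) \<in> parcs G \<Longrightarrow> c (u, v) = c (v, u)"
begin

definition geodesic :: "'a \<Rightarrow> ('a \<times> 'a) awalk \<Rightarrow> 'a \<Rightarrow> bool" where
  "geodesic u p v \<longleftrightarrow>
     apath u p v \<and> (\<forall>q. apath u q v \<longrightarrow> awalk_cost c p \<le> awalk_cost c q)"

text \<open>For \<open>u = v\<close> the only \<open>apath\<close> is the empty one, so that case holds automatically.\<close>

definition geodetic :: bool where
  "geodetic \<longleftrightarrow> (\<forall>u \<in> pverts G. \<forall>v \<in> pverts G. \<exists>!p. geodesic u p v)"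

end

definition map_graph :: "('a \<Rightarrow> 'b) \<Rightarrow> 'a pair_pre_digraph \<Rightarrow> 'b pair_pre_digraph" where
  "map_graph f G = \<lparr> pverts = f ` pverts G, parcs = map_prod f f ` parcs G \<rparr>"

end

theory Submission
  imports Defs
begin

text \<open>
  All distances are kept at most 2. Every pair of vertices of \<open>H\<close> at distance greater than 2 gets a
  new hub joined to both by edges of weight 1; since two hubs never serve the same pair and the two
  vertices of such a pair have no common neighbour along edges of weight 1, this creates no second
  path of length 2. Afterwards any pair involving a hub that still has no path of length at most
  2 is joined by an edge of weight 2, which is a path of length 2 itself and creates no further one.
\<close>

section \<open>Paths of length at most 2 under positive integer weights\<close>

locale integer_weighted_graph = weighted_graph +
  assumes weight_pos_int: "e \<in> parcs G \<Longrightarrow> c e \<in> \<int> \<and> c e > 0"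
begin

definition unit_arc :: "'a \<Rightarrow> 'a \<Rightarrow> bool" where
  "unit_arc u v \<longleftrightarrow> (u, v) \<in> parcs G \<and> c (u, v) = 1"

text \<open>The length is exactly 2, minimal or not: vertices joined by a unit edge may have such a
  path too, and then it is no geodesic.\<close>

definition two_path :: "'a \<Rightarrow> ('a \<times> 'a) awalk \<Rightarrow> 'a \<Rightarrow> bool" where
  "two_path u p v \<longleftrightarrow> apath u p v \<and> awalk_cost c p = 2"

lemma unit_arc_sym: "unit_arc u v \<Longrightarrow> unit_arc v u"
  using arcs_symmetric weight_sym by (auto simp: unit_arc_def)

lemma unit_arc_in_verts: "unit_arc u v \<Longrightarrow> u \<in> pverts G \<and> v \<in> pverts G"
  using wellformed' by (auto simp: unit_arc_def)

lemma unit_arc_irrefl: "\<not> unit_arc u u"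
  using no_loops' by (auto simp: unit_arc_def)

lemma weight_ge_1:
  assumes "e \<in> parcs G" shows "c e \<ge> 1"
proof -
  obtain k where "c e = of_int k" using weight_pos_int[OF assms] by (auto elim: Ints_cases)
  with weight_pos_int[OF assms] show ?thesis by auto
qed

lemma weight_int:
  assumes "e \<in> parcs G" "c e \<noteq> 1" shows "c e \<ge> 2"
proof -
  obtain k where "c e = of_int k" using weight_pos_int[OF assms(1)] by (auto elim: Ints_cases)
  with weight_ge_1[OF assms(1)] assms(2) show ?thesis by auto
qed

lemma length_le_cost: "set p \<subseteq> parcs G \<Longrightarrow> real (length p) \<le> awalk_cost c p"
proof (induction p)
  case (Cons e p)
  then show ?case using weight_ge_1[of e] by simp
qed simp

lemma apath_arcs: "apath u p v \<Longrightarrow> set p \<subseteq> parcs G"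
  by (auto simp: apath_def)

lemma apath_single: "apath u [e] v \<longleftrightarrow> e = (u, v) \<and> (u, v) \<in> parcs G"
  by (cases e) (auto simp: apath_simps dest: wellformed' no_loops')

lemma apath_loop: "apath u p u \<longleftrightarrow> p = [] \<and> u \<in> pverts G"
  using apath_nonempty_ends[of u p u] by (cases "p = []") (auto simp: apath_Nil_iff)

text \<open>Every arc weighs at least 1, so a path of length 2 has at most two arcs, and if it has
  two, both weigh exactly 1.\<close>

lemma two_path_iff:
  assumes "u \<noteq> v"
  shows "two_path u p v \<longleftrightarrow> p = [(u, v)] \<and> (u, v) \<in> parcs G \<and> c (u, v) = 2 \<or>
    (\<exists>w. p = [(u, w), (w, v)] \<and> unit_arc u w \<and> unit_arc w v)"  (is "?L \<longleftrightarrow> ?R")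
proof
  assume ?L
  then have p: "apath u p v" "awalk_cost c p = 2" by (auto simp: two_path_def)
  with length_le_cost[OF apath_arcs] have "length p \<le> 2" by fastforce
  moreover have "p \<noteq> []" using p(1) assms by (auto simp: apath_Nil_iff)
  ultimately consider e where "p = [e]" | e f where "p = [e, f]"
    by (cases p; cases "tl p"; cases "tl (tl p)") auto
  then show ?R
  proof cases
    case 1
    then show ?thesis using p by (auto simp: apath_single)
  next
    case 2
    then obtain w where w: "p = [(u, w), (w, v)]" "(u, w) \<in> parcs G" "(w, v) \<in> parcs G"
      using p(1) by (cases e; cases f) (auto simp: apath_simps)
    with p(2) weight_ge_1[of "(u, w)"] weight_ge_1[of "(w, v)"] show ?thesis
      by (auto simp: unit_arc_def)
  qed
next
  assume ?R
  then show ?L using assms wellformed' no_loops'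
    by (auto simp: two_path_def apath_single apath_simps unit_arc_def)
qed

text \<open>Two or more arcs already cost 2; a single arc would have to be \<open>(u, v)\<close>,
  whose weight is an integer other than 1.\<close>

lemma non_unit_cost_ge_2:
  assumes "u \<noteq> v" "\<not> unit_arc u v" "apath u p v"
  shows "awalk_cost c p \<ge> 2"
proof (cases "length p \<ge> 2")
  case True
  then show ?thesis using length_le_cost[OF apath_arcs[OF assms(3)]] by linarith
next
  case False
  moreover have "p \<noteq> []" using assms by (auto simp: apath_Nil_iff)
  ultimately obtain e where "p = [e]" by (cases p; cases "tl p") auto
  with assms weight_int[of "(u, v)"] show ?thesis by (auto simp: apath_single unit_arc_def)
qed

lemma two_path_geodesic:
  assumes "u \<noteq> v" "\<not> unit_arc u v" "two_path u p v"
  shows "geodesic u p v"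
  using assms non_unit_cost_ge_2 by (auto simp: geodesic_def two_path_def)

text \<open>Vertices joined by a unit edge have that edge as their only geodesic, since any further
  arc raises the length to 2. For other distinct vertices 2 is a lower bound on the length, so once
  a path of length 2 exists, the geodesics are exactly these paths.\<close>

lemma geodeticI:
  assumes "\<And>u v. \<lbrakk>u \<in> pverts G; v \<in> pverts G; u \<noteq> v; \<not> unit_arc u v\<rbrakk> \<Longrightarrow> \<exists>!p. two_path u p v"
  shows geodetic
  unfolding geodetic_def
proof (intro ballI)
  fix u v assume uv: "u \<in> pverts G" "v \<in> pverts G"
  consider "u = v" | "u \<noteq> v" "unit_arc u v" | "u \<noteq> v" "\<not> unit_arc u v" by blast
  then show "\<exists>!p. geodesic u p v"
  proof cases
    case 1
    then show ?thesis using uv by (auto simp: geodesic_def apath_loop)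
  next
    case 2
    then have arc: "apath u [(u, v)] v" "awalk_cost c [(u, v)] = 1"
      by (auto simp: unit_arc_def apath_single)
    \<comment> \<open>The length bounds the number of arcs, so only a single arc can cost at most
      1.\<close>
    have short: "p = [(u, v)]" if "apath u p v" "awalk_cost c p \<le> 1" for p
    proof -
      have "length p \<le> 1" using length_le_cost[OF apath_arcs[OF that(1)]] that(2) by simp
      moreover have "p \<noteq> []" using that 2 by (auto simp: apath_Nil_iff)
      ultimately obtain e where "p = [e]" by (cases p; cases "tl p") auto
      with that show ?thesis by (simp add: apath_single)
    qed
    show ?thesis
    proof (rule ex1I[of _ "[(u, v)]"])
      show "geodesic u [(u, v)] v"
        unfolding geodesic_def using arc short by (metis linear)
      show "p = [(u, v)]" if "geodesic u p v" for p
        using that short arc unfolding geodesic_def by metis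
    qed
  next
    case 3
    then obtain p where p: "two_path u p v" "\<And>q. two_path u q v \<Longrightarrow> q = p"
      using assms uv by metis
    show ?thesis
    proof (rule ex1I[of _ p])
      show "geodesic u p v" using 3 p two_path_geodesic by blast
      show "q = p" if "geodesic u q v" for q
      proof (rule p(2))
        have "awalk_cost c q \<le> 2" using that p(1) by (auto simp: geodesic_def two_path_def)
        with that non_unit_cost_ge_2[OF 3, of q] show "two_path u q v"
          by (auto simp: geodesic_def two_path_def)
      qed
    qed
  qed
qed

section \<open>Pairs of vertices at distance greater than 2\<close>

definition far_pairs :: "'a set set" where
  "far_pairs = {{u, v} |u v. u \<in> pverts G \<and> v \<in> pverts G \<and> u \<noteq> v \<and>
     \<not> unit_arc u v \<and> (\<nexists>p. two_path u p v)}"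

lemma finite_far_pairs: "finite far_pairs"
  by (rule finite_subset[of _ "Pow (pverts G)"]) (auto simp: far_pairs_def pair_finite_verts)

text \<open>Far pairs are unordered while \<open>two_path\<close> has a direction; this lets
  \<open>far_pairD\<close> name the two members in either order.\<close>

lemma two_path_rev: "two_path u p v \<Longrightarrow> \<exists>q. two_path v q u"
proof (cases "u = v")
  case False
  assume "two_path u p v"
  then show ?thesis unfolding two_path_iff[OF False] two_path_iff[OF False[symmetric]]
    by (metis arcs_symmetric unit_arc_sym weight_sym)
qed auto

lemma far_pairD:
  assumes "S \<in> far_pairs" "u \<in> S" "v \<in> S" "u \<noteq> v"
  shows "S = {u, v}" "\<not> unit_arc u v" "\<not> two_path u p v"
  using assms two_path_rev[of u _ v] unit_arc_sym[of u v]
  by (auto simp: far_pairs_def)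

lemma far_pairs_subset: "S \<in> far_pairs \<Longrightarrow> S \<subseteq> pverts G"
  by (auto simp: far_pairs_def)

end

section \<open>Construction of the completion by hubs\<close>

text \<open>The enumeration \<open>pair_of\<close> turns hubs into natural numbers, one for each far
  pair. The uniqueness assumption is the hypothesis on \<open>H\<close>; it spares pairs joined by a
  unit edge, whose paths of length 2 are not geodesics.\<close>

locale hub_completion = integer_weighted_graph +
  fixes k :: nat and pair_of :: "nat \<Rightarrow> 'a set"
  assumes pair_of: "bij_betw pair_of {..<k} far_pairs"
    and two_path_unique: "\<lbrakk>u \<noteq> v; \<not> unit_arc u v; two_path u p v; two_path u q v\<rbrakk> \<Longrightarrow> p = q"
begin

text \<open>This is adjacency by weight 1 in the completion, fixed in advance because the arcs of
  weight 2 are defined from it. Original vertices are tagged \<open>Inl\<close>, hubs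
  \<open>Inr\<close>.\<close>

fun near :: "'a + nat \<Rightarrow> 'a + nat \<Rightarrow> bool" where
  "near (Inl u) (Inl v) \<longleftrightarrow> unit_arc u v"
| "near (Inl u) (Inr n) \<longleftrightarrow> n < k \<and> u \<in> pair_of n"
| "near (Inr n) (Inl u) \<longleftrightarrow> n < k \<and> u \<in> pair_of n"
| "near (Inr m) (Inr n) \<longleftrightarrow> False"

text \<open>The condition on \<open>isl\<close> keeps new arcs away from pairs of original vertices,
  so the original graph stays induced. The midpoint \<open>z\<close> ranges over the whole type, but
  \<open>near_in_verts\<close> confines it to vertices.\<close>

definition completion :: "('a + nat) pair_pre_digraph" where
  "completion = (let V = Inl ` pverts G \<union> Inr ` {..<k} in
     \<lparr> pverts = V,
       parcs = map_prod Inl Inl ` parcs G \<union>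
         {(x, y) \<in> V \<times> V. x \<noteq> y \<and> (isl x \<longrightarrow> \<not> isl y) \<and>
            (near x y \<or> (\<nexists>z. near x z \<and> near z y))} \<rparr>)"

fun weight :: "('a + nat) \<times> ('a + nat) \<Rightarrow> real" where
  "weight (Inl u, Inl v) = c (u, v)"
| "weight (x, y) = (if near x y then 1 else 2)"

lemma pair_of_far: "n < k \<Longrightarrow> pair_of n \<in> far_pairs"
  using pair_of by (auto simp: bij_betw_def)

lemma pair_of_inj: "\<lbrakk>m < k; n < k; pair_of m = pair_of n\<rbrakk> \<Longrightarrow> m = n"
  using pair_of by (auto simp: bij_betw_def inj_on_def)

lemma near_sym: "near x y \<Longrightarrow> near y x"
  by (cases x; cases y) (auto intro: unit_arc_sym)

lemma near_irrefl: "\<not> near x x"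
  by (cases x) (auto simp: unit_arc_irrefl)

lemma near_in_verts: "near x y \<Longrightarrow> x \<in> pverts completion \<and> y \<in> pverts completion"
  using unit_arc_in_verts far_pairs_subset[OF pair_of_far]
  by (cases x; cases y) (fastforce simp: completion_def Let_def)+

lemma weight_hub: "\<not> (isl x \<and> isl y) \<Longrightarrow> weight (x, y) = (if near x y then 1 else 2)"
  by (cases x; cases y) auto

lemma arc_Inl_iff: "(Inl u, Inl v) \<in> parcs completion \<longleftrightarrow> (u, v) \<in> parcs G"
  by (auto simp: completion_def Let_def)

lemma arc_hub_iff:
  assumes "\<not> (isl x \<and> isl y)"
  shows "(x, y) \<in> parcs completion \<longleftrightarrow> x \<in> pverts completion \<and> y \<in> pverts completion \<and>
    x \<noteq> y \<and> (near x y \<or> (\<nexists>z. near x z \<and> near z y))"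
  using assms by (auto simp: completion_def Let_def)

lemma completion_arc_sym:
  assumes "(x, y) \<in> parcs completion"
  shows "(y, x) \<in> parcs completion \<and> weight (x, y) = weight (y, x)"
proof (cases "isl x \<and> isl y")
  case True
  then obtain u v where "x = Inl u" "y = Inl v" by (auto simp: isl_def)
  with assms show ?thesis by (auto simp: arc_Inl_iff arcs_symmetric weight_sym)
next
  case False
  then have "\<not> (isl y \<and> isl x)" by blast
  with False assms show ?thesis
    by (auto simp: arc_hub_iff weight_hub near_sym) (use near_sym in blast)+
qed

text \<open>This makes the path lemmas, in particular \<open>geodeticI\<close>, available for the
  completion itself.\<close>

sublocale completion: integer_weighted_graph completion weight
proof
  have verts: "fst e \<in> pverts completion \<and> snd e \<in> pverts completion \<and> fst e \<noteq> snd e"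
    if "e \<in> parcs completion" for e
    using that wellformed' no_loops' by (auto simp: completion_def Let_def)
  show "fst e \<in> pverts completion" "snd e \<in> pverts completion" "fst e \<noteq> snd e"
    if "e \<in> parcs completion" for e
    using verts[OF that] by auto
  show fin: "finite (pverts completion)"
    by (simp add: completion_def Let_def pair_finite_verts)
  show "finite (parcs completion)"
    by (rule finite_subset[of _ "pverts completion \<times> pverts completion"])
      (use verts fin in \<open>force+\<close>)
  show "symmetric (with_proj completion)"
    using completion_arc_sym by (auto simp: symmetric_def intro: symI)
  show "weight (x, y) = weight (y, x)" if "(x, y) \<in> parcs completion" for x y
    using completion_arc_sym[OF that] by simp
  show "weight e \<in> \<int> \<and> weight e > 0" if "e \<in> parcs completion" for e
    using that weight_pos_int by (cases e rule: weight.cases) (auto simp: arc_Inl_iff)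
qed

section \<open>Uniqueness of paths of length 2 in the completion\<close>

lemma unit_arc_completion: "completion.unit_arc x y \<longleftrightarrow> near x y"
proof (cases "isl x \<and> isl y")
  case True
  then obtain u v where "x = Inl u" "y = Inl v" by (auto simp: isl_def)
  then show ?thesis by (simp add: completion.unit_arc_def arc_Inl_iff unit_arc_def)
next
  case False
  then show ?thesis using near_in_verts near_irrefl
    by (auto simp: completion.unit_arc_def arc_hub_iff weight_hub)
qed

lemma two_path_completion_iff:
  assumes "x \<noteq> y"
  shows "completion.two_path x p y \<longleftrightarrow>
    p = [(x, y)] \<and> (x, y) \<in> parcs completion \<and> weight (x, y) = 2 \<or>
    (\<exists>z. p = [(x, z), (z, y)] \<and> near x z \<and> near z y)"
  by (simp add: completion.two_path_iff[OF assms] unit_arc_completion)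

text \<open>Two midpoints next to a hub would be the two members of its far pair, and the other end
  would be a second common neighbour of them.\<close>

lemma hub_mid_unique:
  assumes "\<not> (isl x \<and> isl y)" "x \<noteq> y" "near x z" "near z y" "near x z'" "near z' y"
  shows "z = z'"
proof (rule ccontr)
  assume ne: "z \<noteq> z'"
  \<comment> \<open>If \<open>t\<close> is an original vertex, it yields a path of length 2 between
    the members of a far pair; if it is a hub, two hubs serve the same pair.\<close>
  have *: False if "n < k" "a \<in> pair_of n" "b \<in> pair_of n" "a \<noteq> b" "near t (Inl a)" "near t (Inl b)"
    "t \<noteq> Inr n" for n a b t
  proof (cases t)
    case (Inl u)
    then have "two_path a [(a, u), (u, b)] b"
      using that unit_arc_sym by (auto simp: two_path_iff)
    with far_pairD(3)[OF pair_of_far] that show False by metis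
  next
    case (Inr m)
    then have m: "m < k" "a \<in> pair_of m" "b \<in> pair_of m" using that by simp_all
    have "pair_of m = {a, b}" "pair_of n = {a, b}"
      using far_pairD(1)[OF pair_of_far] m that by metis+
    with pair_of_inj[of m n] m(1) that(1,7) Inr show False by auto
  qed
  \<comment> \<open>No two hubs are \<open>near\<close>, so both midpoints are original vertices and
    lie in the pair of hub \<open>n\<close>.\<close>
  have hub: False if "t = Inr n" "t \<noteq> s" "near t z" "near s z" "near t z'" "near s z'" for n t s
    using that ne *[of n "projl z" "projl z'" s]
    by (cases z; cases z') auto
  from assms(1) consider n where "x = Inr n" | n where "y = Inr n"
    by (cases x; cases y) auto
  then show False
  proof cases
    case 1
    show False by (rule hub[OF 1 assms(2)]) (use assms near_sym in blast)+
  next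
    case 2
    show False by (rule hub[OF 2 assms(2)[symmetric]]) (use assms near_sym in blast)+
  qed
qed

text \<open>If a hub is involved, the arc of weight 2 is present exactly when there is no midpoint,
  and a midpoint is unique. Between original vertices, old paths of length 2 and paths through a hub
  exclude each other, because hubs serve far pairs only.\<close>

lemma completion_two_path:
  assumes xy: "x \<in> pverts completion" "y \<in> pverts completion" "x \<noteq> y" "\<not> near x y"
  shows "\<exists>!p. completion.two_path x p y"
proof (cases "isl x \<and> isl y")
  case False
  show ?thesis
  proof (cases "\<exists>z. near x z \<and> near z y")
    case True
    then obtain z where z: "near x z" "near z y" by blast
    have "(x, y) \<notin> parcs completion" using False True xy by (auto simp: arc_hub_iff)
    then show ?thesis
      unfolding two_path_completion_iff[OF xy(3)]
      using z hub_mid_unique[OF False xy(3)] by blast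
  next
    case no_mid: False
    with False xy show ?thesis
      by (auto simp: two_path_completion_iff arc_hub_iff weight_hub)
  qed
next
  case True
  then obtain u v where uv: "x = Inl u" "y = Inl v" by (auto simp: isl_def)
  have u: "u \<in> pverts G" "v \<in> pverts G" "u \<noteq> v" "\<not> unit_arc u v"
    using xy uv by (auto simp: completion_def Let_def)
  let ?hub = "\<lambda>n. n < k \<and> u \<in> pair_of n \<and> v \<in> pair_of n"
  let ?lift = "map (map_prod Inl Inl) :: _ \<Rightarrow> (('a + nat) \<times> ('a + nat)) list"
  \<comment> \<open>A direct arc is inherited from \<open>G\<close>; a midpoint is either an
    original vertex, giving a lifted path of \<open>G\<close>, or a hub.\<close>
  have iff: "completion.two_path x p y \<longleftrightarrow> (\<exists>q. two_path u q v \<and> p = ?lift q) \<or>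
      (\<exists>n. ?hub n \<and> p = [(x, Inr n), (Inr n, y)])" for p
    unfolding two_path_completion_iff[OF xy(3)] two_path_iff[OF u(3)]
    unfolding uv by (auto simp: arc_Inl_iff split_sum_ex)
  have hub: "?hub n \<longleftrightarrow> n < k \<and> pair_of n = {u, v}" for n
    using far_pairD(1)[OF pair_of_far _ _ u(3)] by blast
  show ?thesis
  proof (cases "\<exists>q. two_path u q v")
    case True
    then have "{u, v} \<notin> far_pairs" using far_pairD(3)[OF _ _ _ u(3)] by blast
    then have no_hub: "\<not> ?hub n" for n using hub pair_of_far by metis
    from True obtain q where "two_path u q v" ..
    then have "completion.two_path x p y \<longleftrightarrow> p = ?lift q" for p
      using iff[of p] no_hub two_path_unique[OF u(3,4)] by blast
    then show ?thesis by simp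
  next
    case False
    with u have "{u, v} \<in> far_pairs" by (auto simp: far_pairs_def)
    then have "{u, v} \<in> pair_of ` {..<k}" using pair_of by (simp add: bij_betw_def)
    then obtain n where "n < k" "pair_of n = {u, v}" by force
    \<comment> \<open>Injectivity of \<open>pair_of\<close> leaves a single hub for this far
      pair.\<close>
    then have "?hub m \<longleftrightarrow> m = n" for m using hub pair_of_inj by metis
    with False have "completion.two_path x p y \<longleftrightarrow> p = [(x, Inr n), (Inr n, y)]" for p
      using iff[of p] by blast
    then show ?thesis by simp
  qed
qed

lemma geodetic_completion: "completion.geodetic"
  using completion_two_path by (intro completion.geodeticI) (simp_all add: unit_arc_completion)

lemma induced_completion:
  "induced_subgraph (with_proj (map_graph Inl G)) (with_proj completion)"
proof -
  have "wf_digraph (with_proj (map_graph Inl G))"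
    unfolding wf_digraph_wp_iff
    by unfold_locales (auto simp: map_graph_def dest: wellformed')
  moreover have "wf_digraph (with_proj completion)" by unfold_locales
  ultimately show ?thesis
    by (auto simp: induced_subgraph_def subgraph_def compatible_def map_graph_def completion_def
        Let_def dest: wellformed')
qed

lemma weight_new_arc:
  assumes "e \<in> parcs completion - parcs (map_graph Inl G)"
  shows "weight e = 1 \<or> weight e = 2"
  using assms
  by (cases e rule: weight.cases) (auto simp: map_graph_def arc_Inl_iff)

end

theorem theorem9:
  fixes H :: "'a pair_pre_digraph" and c :: "('a \<times> 'a) weight_fun"
  assumes "weighted_graph H c"
    and "\<And>e. e \<in> parcs H \<Longrightarrow> c e \<in> \<int> \<and> c e > 0"
    and "\<not> (\<exists>u \<in> pverts H. \<exists>v \<in> pverts H. \<exists>p q. p \<noteq> q \<and>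
            weighted_graph.geodesic H c u p v \<and> wf_digraph.awalk_cost c p = 2 \<and>
            weighted_graph.geodesic H c u q v \<and> wf_digraph.awalk_cost c q = 2)"
  shows "\<exists>(G :: ('a + nat) pair_pre_digraph) d.
           weighted_graph G d \<and> weighted_graph.geodetic G d \<and>
           induced_subgraph (with_proj (map_graph Inl H)) (with_proj G) \<and>
           (\<forall>(u, v) \<in> parcs H. d (Inl u, Inl v) = c (u, v)) \<and>
           (\<forall>e \<in> parcs G - parcs (map_graph Inl H). d e = 1 \<or> d e = 2)"
proof -
  interpret H: integer_weighted_graph H c
    using assms(1,2) by (simp add: integer_weighted_graph_def integer_weighted_graph_axioms_def)
  obtain pair_of where "bij_betw pair_of {0..<card H.far_pairs} H.far_pairs"
    using ex_bij_betw_nat_finite[OF H.finite_far_pairs] by blast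
  then interpret hub_completion H c "card H.far_pairs" pair_of
  proof unfold_locales
    fix u v p q
    assume uv: "u \<noteq> v" "\<not> H.unit_arc u v" and pq: "H.two_path u p v" "H.two_path u q v"
    then have "u \<in> pverts H" "v \<in> pverts H"
      by (auto simp: H.two_path_def H.apath_def)
    \<comment> \<open>Without a unit edge between \<open>u\<close> and \<open>v\<close>, both paths
      are geodesics of length 2, so the hypothesis on \<open>H\<close> forbids them to
      differ.\<close>
    with assms(3) H.two_path_geodesic[OF uv pq(1)] H.two_path_geodesic[OF uv pq(2)] pq
    show "p = q" unfolding H.two_path_def by blast
  qed (simp add: atLeast0LessThan)
  show ?thesis
    using completion.weighted_graph_axioms geodetic_completion induced_completion weight_new_arc
    by (intro exI[of _ completion] exI[of _ weight]) auto
qed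

end
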